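(* Let $M$ be a non-planar translating soliton in $\mathbb{E}_1^3$ with respect to a nonzero vector $\vec v$. Assume that $M$ is a non-cylindrical ruled surface parametrized by $X(s,t)=\gamma(s)+t\,w(s)$. Then, after a reparametrization of the surface, the curve $s\mapsto w(s)$ is a lightlike straight line (that is, $w(s)=s\,\vec a+\vec b$ for constant vectors $\vec a,\vec b$ with $\vec a\ne0$ lightlike) and $\langle w',\vec v\rangle=0$.
   Context: $\mathbb{E}_1^3$ is $\mathbb{R}^3$ with coordinates $(x,y,z)$ and metric $\langle\,,\rangle=dx^2+dy^2-dz^2$. A nonzero vector $a$ is spacelike, timelike or lightlike if $\langle a,a\rangle$ is $>0$, $<0$ or $=0$. A (connected, smooth) surface $M$ is non-degenerate if its induced metric is non-degenerate. Let $N$ be a (local) unit normal field, $\epsilon=\langle N,N\rangle\in\{-1,1\}$, and $\sigma$ the second fundamental form, $\nabla^0_UV=\nabla_UV+\sigma(U,V)$. The mean curvature vector is $\vec H=\frac12\,\mathrm{trace}(\sigma)$ (trace with respect to the induced metric), and the mean curvature $H$ is defined by $\vec H=HN$. A translating soliton with respect to a nonzero vector $\vec v$ is a non-degenerate surface with $2H=\langle N,\vec v\rangle$ at every point. A ruled surface is parametrized by $X(s,t)=\gamma(s)+t\,w(s)$, $(s,t)\in I\times J$ with $I,J$ open intervals, where $\gamma$ is a smooth regular curve and $w$ is a smooth nowhere vanishing vector field along $\gamma$. Non-cylindrical means that the direction of the rulings is nowhere constant: after shrinking $I$, $w(s)$ and $w'(s)$ are linearly independent for all $s\in I$. It is assumed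 that causal characters do not change along $I$: either $w(s)$ is lightlike for all $s$, or $w$ is nowhere lightlike and is normalized so that $\langle w,w\rangle=\delta\in\{-1,1\}$, in which case $w'(s)$ is either lightlike for all $s\in I$ or lightlike for no $s\in I$. Reparametrization allows changing the parameter $s$, rescaling $w$ by a nowhere zero function, and replacing $\gamma$ by $\gamma+\lambda w$ with $\lambda=\lambda(s)$ smooth. *)

theory Defs
  imports "HOL-Analysis.Analysis"
begin

section \<open>Minkowski space\<close>

definition mink :: "real^3 \<Rightarrow> real^3 \<Rightarrow> real" where
  "mink a b = a$1 * b$1 + a$2 * b$2 - a$3 * b$3"

definition lightlike :: "real^3 \<Rightarrow> bool" where
  "lightlike a \<longleftrightarrow> a \<noteq> 0 \<and> mink a a = 0"

section \<open>Intervals and smooth maps\<close>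

definition open_interval :: "real set \<Rightarrow> bool" where
  "open_interval I \<longleftrightarrow> open I \<and> is_interval I \<and> I \<noteq> {}"

definition vderiv :: "(real \<Rightarrow> 'a::real_normed_vector) \<Rightarrow> real \<Rightarrow> 'a" where
  "vderiv f s = vector_derivative f (at s)"

text \<open>\<open>C\<^sup>\<infinity>\<close> on an open set of reals: every iterated derivative is again differentiable there.\<close>

definition smooth_fun_on :: "real set \<Rightarrow> (real \<Rightarrow> 'a::real_normed_vector) \<Rightarrow> bool" where
  "smooth_fun_on I f \<longleftrightarrow> (\<forall>n. (vderiv ^^ n) f differentiable_on I)"

section \<open>Extrinsic geometry of a parametrized surface\<close>

type_synonym psurface = "real \<Rightarrow> real \<Rightarrow> real^3"

definition d1 :: "psurface \<Rightarrow> psurface" where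
  "d1 X s t = vderiv (\<lambda>s'. X s' t) s"

definition d2 :: "psurface \<Rightarrow> psurface" where
  "d2 X s t = vderiv (\<lambda>t'. X s t') t"

definition tangent_plane :: "psurface \<Rightarrow> real \<Rightarrow> real \<Rightarrow> (real^3) set" where
  "tangent_plane X s t = span {d1 X s t, d2 X s t}"

definition fffE :: "psurface \<Rightarrow> real \<Rightarrow> real \<Rightarrow> real" where
  "fffE X s t = mink (d1 X s t) (d1 X s t)"

definition fffF :: "psurface \<Rightarrow> real \<Rightarrow> real \<Rightarrow> real" where
  "fffF X s t = mink (d1 X s t) (d2 X s t)"

definition fffG :: "psurface \<Rightarrow> real \<Rightarrow> real \<Rightarrow> real" where
  "fffG X s t = mink (d2 X s t) (d2 X s t)"

definition fff_det :: "psurface \<Rightarrow> real \<Rightarrow> real \<Rightarrow> real" where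
  "fff_det X s t = fffE X s t * fffG X s t - (fffF X s t)\<^sup>2"

text \<open>The induced metric is non-degenerate at \<open>(s,t)\<close>; this includes that \<open>X\<close> is an immersion there,
  since the Gram determinant of linearly dependent vectors vanishes.\<close>

definition nondegenerate_at :: "psurface \<Rightarrow> real \<Rightarrow> real \<Rightarrow> bool" where
  "nondegenerate_at X s t \<longleftrightarrow> fff_det X s t \<noteq> 0"

text \<open>The component normal to the surface in the decomposition of a vector into tangential and
  normal parts. It is uniquely determined where the induced metric is non-degenerate.\<close>

definition normal_part :: "psurface \<Rightarrow> real \<Rightarrow> real \<Rightarrow> real^3 \<Rightarrow> real^3" where
  "normal_part X s t u =
    (THE n. u - n \<in> tangent_plane X s t \<and> (\<forall>y\<in>tangent_plane X s t. mink n y = 0))"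

text \<open>Gauss formula on coordinate fields: the flat derivative \<open>\<nabla>\<^sup>0\<close> of \<open>X\<^sub>j\<close> along \<open>X\<^sub>i\<close> is the second
  partial derivative \<open>X\<^sub>i\<^sub>j\<close>, and its normal component is \<open>\<sigma>(X\<^sub>i, X\<^sub>j)\<close>.\<close>

definition sff11 :: "psurface \<Rightarrow> psurface" where
  "sff11 X s t = normal_part X s t (d1 (d1 X) s t)"

definition sff12 :: "psurface \<Rightarrow> psurface" where
  "sff12 X s t = normal_part X s t (d2 (d1 X) s t)"

definition sff22 :: "psurface \<Rightarrow> psurface" where
  "sff22 X s t = normal_part X s t (d2 (d2 X) s t)"

text \<open>Half the metric trace \<open>\<Sum> g\<^sup>i\<^sup>j \<sigma>(X\<^sub>i, X\<^sub>j)\<close>, with the \<open>2 \<times> 2\<close> inverse of the induced metric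
  written out.\<close>

definition mean_curvature_vector :: "psurface \<Rightarrow> psurface" where
  "mean_curvature_vector X s t =
    (1/2) *\<^sub>R ((1 / fff_det X s t) *\<^sub>R
      (fffG X s t *\<^sub>R sff11 X s t - (2 * fffF X s t) *\<^sub>R sff12 X s t + fffE X s t *\<^sub>R sff22 X s t))"

definition unit_normal :: "psurface \<Rightarrow> real \<Rightarrow> real \<Rightarrow> real^3 \<Rightarrow> bool" where
  "unit_normal X s t N \<longleftrightarrow>
    (\<forall>y\<in>tangent_plane X s t. mink N y = 0) \<and> mink N N \<in> {-1, 1}"

text \<open>\<open>H\<close> is the mean curvature with respect to the unit normal \<open>N\<close>. The equation
  \<open>2 H = \<langle>N, v\<rangle>\<close> is invariant under \<open>(N, H) \<mapsto> (- N, - H)\<close>, so it can be imposed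
  pointwise for both unit normals, without choosing a normal field.\<close>

definition is_mean_curvature ::
    "psurface \<Rightarrow> real \<Rightarrow> real \<Rightarrow> real^3 \<Rightarrow> real \<Rightarrow> bool" where
  "is_mean_curvature X s t N H \<longleftrightarrow> mean_curvature_vector X s t = H *\<^sub>R N"

definition translating_soliton ::
    "real set \<Rightarrow> real set \<Rightarrow> psurface \<Rightarrow> real^3 \<Rightarrow> bool" where
  "translating_soliton I J X v \<longleftrightarrow>
    (\<forall>s\<in>I. \<forall>t\<in>J. nondegenerate_at X s t \<and>
      (\<forall>N. unit_normal X s t N \<longrightarrow>
        (\<exists>H. is_mean_curvature X s t N H \<and> 2 * H = mink N v)))"

section \<open>Ruled surfaces\<close>

definition ruled :: "(real \<Rightarrow> real^3) \<Rightarrow> (real \<Rightarrow> real^3) \<Rightarrow> psurface" where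
  "ruled \<gamma> w s t = \<gamma> s + t *\<^sub>R w s"

definition ruled_data :: "real set \<Rightarrow> (real \<Rightarrow> real^3) \<Rightarrow> (real \<Rightarrow> real^3) \<Rightarrow> bool" where
  "ruled_data I \<gamma> w \<longleftrightarrow>
    smooth_fun_on I \<gamma> \<and> (\<forall>s\<in>I. vderiv \<gamma> s \<noteq> 0) \<and>
    smooth_fun_on I w \<and> (\<forall>s\<in>I. w s \<noteq> 0)"

definition non_cylindrical :: "real set \<Rightarrow> (real \<Rightarrow> real^3) \<Rightarrow> bool" where
  "non_cylindrical I w \<longleftrightarrow>
    (\<forall>s\<in>I. \<forall>a b. a *\<^sub>R w s + b *\<^sub>R vderiv w s = 0 \<longrightarrow> a = 0 \<and> b = 0)"

definition constant_causal_type :: "real set \<Rightarrow> (real \<Rightarrow> real^3) \<Rightarrow> bool" where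
  "constant_causal_type I w \<longleftrightarrow>
    (\<forall>s\<in>I. lightlike (w s)) \<or>
    (\<exists>\<delta>\<in>{-1, 1}. (\<forall>s\<in>I. mink (w s) (w s) = \<delta>) \<and>
      ((\<forall>s\<in>I. lightlike (vderiv w s)) \<or> (\<forall>s\<in>I. \<not> lightlike (vderiv w s))))"

text \<open>The allowed reparametrizations: a change of parameter \<open>\<phi> : I' \<rightarrow> I\<close>, a rescaling of the
  rulings by a nowhere zero \<open>\<mu>\<close>, and a shift of the base curve along the rulings by \<open>\<nu>\<close>. Since
  \<open>\<gamma>'(s) + t w'(s) = \<gamma>(\<phi>(s)) + (\<nu>(s) + t \<mu>(s)) w(\<phi>(s))\<close>, these are changes of
  coordinates \<open>(s,t) \<mapsto> (\<phi>(s), \<nu>(s) + t \<mu>(s))\<close> on the same surface.\<close>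

definition ruled_reparametrization ::
    "real set \<Rightarrow> (real \<Rightarrow> real^3) \<Rightarrow> (real \<Rightarrow> real^3) \<Rightarrow>
     real set \<Rightarrow> (real \<Rightarrow> real^3) \<Rightarrow> (real \<Rightarrow> real^3) \<Rightarrow> bool" where
  "ruled_reparametrization I \<gamma> w I' \<gamma>' w' \<longleftrightarrow>
    open_interval I' \<and> ruled_data I' \<gamma>' w' \<and>
    (\<exists>\<phi> \<mu> \<nu>.
      smooth_fun_on I' \<phi> \<and> (\<forall>s\<in>I'. vderiv \<phi> s \<noteq> 0) \<and> bij_betw \<phi> I' I \<and>
      smooth_fun_on I' \<mu> \<and> (\<forall>s\<in>I'. \<mu> s \<noteq> 0) \<and> smooth_fun_on I' \<nu> \<and>
      (\<forall>s\<in>I'. w' s = \<mu> s *\<^sub>R w (\<phi> s)) \<and>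
      (\<forall>s\<in>I'. \<gamma>' s = \<gamma> (\<phi> s) + \<nu> s *\<^sub>R w (\<phi> s)))"

end

theory Submission
  imports Defs
begin

text \<open>
  Write \<open>n = X\<^sub>s \<times> X\<^sub>t\<close> for the Euclidean cross product and \<open>D = E G - F\<^sup>2\<close>. The vector \<open>n\<close> with its third
  coordinate negated is Minkowski-normal to the surface and has Minkowski square \<open>- D\<close>. For a ruled
  surface \<open>X\<^sub>t\<^sub>t = 0\<close>, and the soliton equation becomes an identity between determinants
  (lemma \<open>soliton_determinant_equation\<close>):
  \<open>G (X\<^sub>s\<^sub>s \<bullet> n) - 2 F (X\<^sub>s\<^sub>t \<bullet> n) = - \<bar>D\<bar> (v \<bullet> n)\<close>. Along one ruling both sides are, up to the sign
  of \<open>D\<close>, polynomials in \<open>t\<close>: in the situations considered here \<open>\<langle>w, w\<rangle>\<close> is constant, hence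
  \<open>\<langle>w, w'\<rangle> = 0\<close>, and the degree is at most \<open>2\<close> on the left and at most \<open>3\<close> on the right. One of the two signs
  occurs for infinitely many \<open>t\<close>, so the coefficients can be compared (lemma \<open>coefficient_equations\<close>).

  Three causal types have to be considered.

  \<^item> If \<open>w\<close> is lightlike, then \<open>G = 0\<close> and \<open>D = - \<langle>\<gamma>', w\<rangle>\<^sup>2 \<noteq> 0\<close>, and the coefficient of \<open>t\<close> forces
    \<open>det(v, w', w) = 0\<close>. Since \<open>w\<close> is orthogonal to \<open>w\<close> and \<open>w'\<close>, this gives \<open>\<langle>v, w\<rangle> = 0\<close> for all \<open>s\<close>, and
    by differentiation \<open>\<langle>v, w'\<rangle> = 0\<close>. Hence \<open>v\<close> is parallel to \<open>w\<close> for all \<open>s\<close>, so the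
    direction of \<open>w\<close> is constant, which is excluded (lemma \<open>rulings_not_lightlike\<close>).

  \<^item> If \<open>\<langle>w, w\<rangle> = \<delta> \<noteq> 0\<close> and \<open>w'\<close> is not lightlike, the coefficient of \<open>t\<^sup>3\<close> gives \<open>det(v, w', w) = 0\<close>.
    So \<open>w\<close> moves in a plane containing \<open>v\<close>; then \<open>det(w'', w', w) = 0\<close>, the coefficient of \<open>t\<^sup>2\<close> gives
    \<open>det(v, \<gamma>', w) = 0\<close>, and the surface lies in a plane (lemma \<open>planar_if_w1_not_lightlike\<close>).

  \<^item> If \<open>\<langle>w, w\<rangle> = \<delta> \<noteq> 0\<close> and \<open>w'\<close> is lightlike, then \<open>w'\<close> and \<open>w''\<close> are both orthogonal to \<open>w\<close> and \<open>w'\<close>, hence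
    parallel, so \<open>w'\<close> has a constant direction \<open>a\<close> and \<open>w = g a + b\<close> with a strictly increasing
    function \<open>g\<close>, which serves as the new parameter (lemma \<open>lightlike_line_if_w1_lightlike\<close>). The
    coefficient of \<open>t\<^sup>2\<close> is now \<open>\<langle>\<gamma>', w'\<rangle> det(v, w', w) = 0\<close>; non-degeneracy excludes
    \<open>\<langle>\<gamma>', w'\<rangle> = 0\<close>, so \<open>v\<close> lies in the plane spanned by \<open>w\<close> and \<open>w'\<close>, which is orthogonal
    to \<open>w'\<close> (lemma \<open>lightlike_w1_orthogonal_v\<close>).
\<close>

unbundle cross3_syntax

section \<open>Linear algebra of the Minkowski form\<close>

lemmas mink_coords = mink_def cross_components inner_vec_def sum_3 vec_eq_iff forall_3

lemma mink_commute: "mink a b = mink b a"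
  by (simp add: mink_def)

lemma mink_linear_simps:
  "mink (a + b) c = mink a c + mink b c" "mink c (a + b) = mink c a + mink c b"
  "mink (a - b) c = mink a c - mink b c" "mink c (a - b) = mink c a - mink c b"
  "mink (r *\<^sub>R a) c = r * mink a c" "mink c (r *\<^sub>R a) = r * mink c a"
  "mink 0 c = 0" "mink c 0 = 0"
  by (simp_all add: mink_def algebra_simps)

text \<open>The reflection relating the two forms: \<open>\<langle>x, flip y\<rangle> = x \<bullet> y\<close>. It turns a Euclidean normal of a plane
  into a Minkowski normal, so that the Euclidean cross product can be used throughout.\<close>

definition flip :: "real^3 \<Rightarrow> real^3" where
  "flip x = vector [x$1, x$2, - (x$3)]"

lemma flip_components [simp]: "flip x $ 1 = x$1" "flip x $ 2 = x$2" "flip x $ 3 = - (x$3)"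
  by (simp_all add: flip_def)

lemma inner_flip: "x \<bullet> flip y = mink x y"
  by (simp add: mink_coords)

lemma mink_flip: "mink x (flip y) = x \<bullet> y"
  by (simp add: mink_coords)

lemma flip_eq_0_iff [simp]: "flip x = 0 \<longleftrightarrow> x = 0"
  by (simp add: vec_eq_iff forall_3)

text \<open>Lagrange's identity for the Minkowski form; the minus sign is the determinant of the form. It
  makes a plane degenerate exactly when its normal is isotropic.\<close>

lemma mink_normal_self:
  "mink (flip (a \<times> b)) (flip (a \<times> b)) = - (mink a a * mink b b - (mink a b)\<^sup>2)"
  by (simp add: mink_coords power2_eq_square) algebra

lemma cross_cross_triple: "(a \<times> b) \<times> (a \<times> c) = (a \<bullet> (b \<times> c)) *\<^sub>R a"
  by (simp add: mink_coords algebra_simps)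

text \<open>Orthogonally to both \<open>a\<close> and \<open>b\<close> there is only the line of \<open>a \<times> b\<close> (if \<open>a\<close> and \<open>b\<close> are independent); the factor
  \<open>\<bar>a \<times> b\<bar>\<^sup>2\<close> on the left avoids a division.\<close>

lemma orthogonal_pair_imp_multiple_of_cross:
  assumes "x \<bullet> a = 0" "x \<bullet> b = 0"
  shows "((a \<times> b) \<bullet> (a \<times> b)) *\<^sub>R x = (x \<bullet> (a \<times> b)) *\<^sub>R (a \<times> b)"
proof -
  have "(a \<times> b) \<times> (x \<times> (a \<times> b)) = ((a \<times> b) \<bullet> (a \<times> b)) *\<^sub>R x - ((a \<times> b) \<bullet> x) *\<^sub>R (a \<times> b)"
    by (rule Lagrange)
  moreover have "x \<times> (a \<times> b) = 0"
    using assms by (simp add: Lagrange)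
  ultimately show ?thesis
    by (simp add: inner_commute)
qed

text \<open>Cramer's rule for \<open>v\<close> in the basis \<open>a, b, a \<times> b\<close>.\<close>

lemma in_span_cross:
  assumes "v \<bullet> (a \<times> b) = 0" "a \<times> b \<noteq> 0"
  obtains p q where "v = p *\<^sub>R a + q *\<^sub>R b"
proof -
  let ?n = "a \<times> b"
  \<comment> \<open>The three coefficients are the determinants of Cramer's rule, as \<open>det(a, b, n) = n \<bullet> n\<close>.\<close>
  have "(?n \<bullet> ?n) *\<^sub>R v = ((v \<times> b) \<bullet> ?n) *\<^sub>R a + ((a \<times> v) \<bullet> ?n) *\<^sub>R b + (v \<bullet> ?n) *\<^sub>R ?n"
    by (simp add: mink_coords algebra_simps)
  then have e: "(?n \<bullet> ?n) *\<^sub>R v = ((v \<times> b) \<bullet> ?n) *\<^sub>R a + ((a \<times> v) \<bullet> ?n) *\<^sub>R b"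
    using assms(1) by simp
  have nz: "?n \<bullet> ?n \<noteq> 0"
    using assms(2) by simp
  have "v = (1 / (?n \<bullet> ?n)) *\<^sub>R ((?n \<bullet> ?n) *\<^sub>R v)"
    using nz by simp
  also have "\<dots> = ((v \<times> b) \<bullet> ?n / (?n \<bullet> ?n)) *\<^sub>R a + ((a \<times> v) \<bullet> ?n / (?n \<bullet> ?n)) *\<^sub>R b"
    unfolding e by (simp add: scaleR_add_right)
  finally show ?thesis
    by (rule that)
qed

text \<open>The orthogonal complement of a plane with respect to the Minkowski form is a line, even if the
  plane is degenerate and contains that line.\<close>

lemma mink_orthogonal_two_parallel:
  assumes "mink x a = 0" "mink x b = 0" "mink y a = 0" "mink y b = 0" "a \<times> b \<noteq> 0"
  shows "x \<times> y = 0"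
proof -
  let ?n = "a \<times> b"
  have x: "(?n \<bullet> ?n) *\<^sub>R flip x = (flip x \<bullet> ?n) *\<^sub>R ?n"
   and y: "(?n \<bullet> ?n) *\<^sub>R flip y = (flip y \<bullet> ?n) *\<^sub>R ?n"
    by (rule orthogonal_pair_imp_multiple_of_cross;
        metis assms inner_flip inner_commute mink_commute)+
  have "((?n \<bullet> ?n) *\<^sub>R flip x) \<times> ((?n \<bullet> ?n) *\<^sub>R flip y) = 0"
    unfolding x y by (simp add: cross_mult_left cross_mult_right)
  then have "flip x \<times> flip y = 0"
    using assms(5) by (simp add: cross_mult_left cross_mult_right)
  then show ?thesis
    by (simp add: mink_coords)
qed

text \<open>Expanding \<open>det(a, b, c) n\<close> in the dual basis \<open>b \<times> c, c \<times> a, a \<times> b\<close> leaves only the vanishing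
  inner products with \<open>n\<close>.\<close>

lemma triple_eq_0_if_orthogonal:
  assumes "a \<bullet> n = 0" "b \<bullet> n = 0" "c \<bullet> n = 0" "n \<noteq> 0"
  shows "a \<bullet> (b \<times> c) = 0"
proof (rule ccontr)
  assume nz: "a \<bullet> (b \<times> c) \<noteq> 0"
  have "(a \<bullet> (b \<times> c)) *\<^sub>R n = (n \<bullet> a) *\<^sub>R (b \<times> c) + (n \<bullet> b) *\<^sub>R (c \<times> a) + (n \<bullet> c) *\<^sub>R (a \<times> b)"
    by (simp add: mink_coords algebra_simps)
  then show False
    using assms nz by (simp add: inner_commute)
qed

lemma span_pair_eq_orthogonal_cross:
  assumes "a \<times> b \<noteq> 0"
  shows "span {a, b} = {y. y \<bullet> (a \<times> b) = 0}"
proof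
  show "span {a, b} \<subseteq> {y. y \<bullet> (a \<times> b) = 0}"
    by (auto simp: span_insert span_empty inner_diff_left dot_cross_self)
       (metis dot_cross_self(1,2) eq_iff_diff_eq_0 inner_diff_left inner_scaleR_left)
  show "{y. y \<bullet> (a \<times> b) = 0} \<subseteq> span {a, b}"
  proof
    fix y assume "y \<in> {y. y \<bullet> (a \<times> b) = 0}"
    then obtain p q where "y = p *\<^sub>R a + q *\<^sub>R b"
      using in_span_cross[of y a b] assms by auto
    then show "y \<in> span {a, b}"
      by (simp add: span_add span_base span_mul)
  qed
qed

lemma coplanar_if_inner_cross_const:
  assumes e: "a \<times> b \<noteq> 0" and c: "\<And>x. x \<in> S \<Longrightarrow> x \<bullet> (a \<times> b) = c"
  shows "coplanar S"
proof (cases "S = {}")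
  case False
  then obtain p where p: "p \<in> S" by blast
  have "S \<subseteq> affine hull {p, p + a, p + b}"
  proof
    fix x assume "x \<in> S"
    then have "(x - p) \<bullet> (a \<times> b) = 0"
      using c p by (simp add: inner_diff_left)
    then obtain r q where "x - p = r *\<^sub>R a + q *\<^sub>R b"
      using in_span_cross e by blast
    then have "x = (1 - r - q) *\<^sub>R p + r *\<^sub>R (p + a) + q *\<^sub>R (p + b)"
      by (simp add: algebra_simps)
    then show "x \<in> affine hull {p, p + a, p + b}"
      unfolding affine_hull_3 by (smt (verit) mem_Collect_eq)
  qed
  then show ?thesis
    unfolding coplanar_def by blast
qed (simp add: coplanar_def)

section \<open>Smooth maps on open sets of reals\<close>

lemma smooth_has_vderiv:
  assumes "open I" "smooth_fun_on I f" "s \<in> I"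
  shows "(f has_vector_derivative vderiv f s) (at s)"
proof -
  have "f differentiable_on I"
    using assms(2) unfolding smooth_fun_on_def by (metis funpow_0)
  then have "f differentiable at s"
    using assms by (metis differentiable_on_def at_within_open)
  then show ?thesis
    by (simp add: vderiv_def vector_derivative_works)
qed

lemma smooth_vderiv:
  assumes "smooth_fun_on I f"
  shows "smooth_fun_on I (vderiv f)"
proof -
  have "(vderiv ^^ n) (vderiv f) = (vderiv ^^ Suc n) f" for n
    by (simp only: funpow_Suc_right o_def)
  then show ?thesis
    using assms unfolding smooth_fun_on_def by metis
qed

lemma vderiv_eqI: "(f has_vector_derivative f') (at s) \<Longrightarrow> vderiv f s = f'"
  by (simp add: vderiv_def vector_derivative_at)

text \<open>Smoothness is coinductive: it suffices to put the function into some family that is closed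
  under differentiation on the open set. This replaces inductions over the order of
  differentiation by the search for such a family.\<close>

lemma smooth_coinduct:
  assumes "open I" and "f \<in> F"
    and step: "\<And>f. f \<in> F \<Longrightarrow> \<exists>f'\<in>F. \<forall>s\<in>I. (f has_vector_derivative f' s) (at s)"
  shows "smooth_fun_on I f"
proof -
  have *: "\<exists>h\<in>F. \<forall>s\<in>I. (vderiv ^^ n) f s = h s" for n
  proof (induction n)
    case 0
    then show ?case using assms(2) by auto
  next
    case (Suc n)
    then obtain h where h: "h \<in> F" "\<forall>s\<in>I. (vderiv ^^ n) f s = h s" by blast
    then obtain h' where h': "h' \<in> F" "\<forall>s\<in>I. (h has_vector_derivative h' s) (at s)"
      using step by blast
    have "((vderiv ^^ n) f has_vector_derivative h' s) (at s)" if "s \<in> I" for s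
      using has_vector_derivative_transform_within_open[OF _ assms(1) that] h h' that by metis
    then have "\<forall>s\<in>I. (vderiv ^^ Suc n) f s = h' s"
      by (simp add: vderiv_eqI)
    with h'(1) show ?case by blast
  qed
  show ?thesis
    unfolding smooth_fun_on_def
  proof
    fix n
    obtain h where h: "h \<in> F" "\<forall>s\<in>I. (vderiv ^^ n) f s = h s" using * by blast
    then obtain h' where h': "\<forall>s\<in>I. (h has_vector_derivative h' s) (at s)"
      using step by blast
    have "((vderiv ^^ n) f has_vector_derivative h' s) (at s)" if "s \<in> I" for s
      using has_vector_derivative_transform_within_open[OF _ assms(1) that] h h' that by metis
    then show "(vderiv ^^ n) f differentiable_on I"
      by (meson differentiable_at_imp_differentiable_on differentiableI_vector)
  qed
qed

lemma smooth_const: "open I \<Longrightarrow> smooth_fun_on I (\<lambda>s. c)"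
  by (rule smooth_coinduct[where F = "range (\<lambda>c s. c)"])
     (auto intro!: exI[of _ 0] has_vector_derivative_const)

lemma smooth_ident: "open I \<Longrightarrow> smooth_fun_on I (\<lambda>s. s)"
  by (rule smooth_coinduct[where F = "insert (\<lambda>s. s) (range (\<lambda>c s. c))"])
     (auto intro: has_vector_derivative_id has_vector_derivative_const)

text \<open>The inverse \<open>\<phi>\<close> of a function with derivative \<open>q\<close> satisfies \<open>(h \<circ> \<phi>)' = (h' / q) \<circ> \<phi>\<close>. A family of
  functions \<open>h\<close> for which the compositions \<open>h \<circ> \<phi>\<close> are closed under differentiation must therefore
  be closed under \<open>h \<mapsto> h' / q\<close>; the rules below add just what the product and quotient rules
  require for this.\<close>

inductive quotient_closure :: "real set \<Rightarrow> (real \<Rightarrow> real) \<Rightarrow> (real \<Rightarrow> 'a::real_normed_vector) \<Rightarrow> bool"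
  for I q where
  base: "smooth_fun_on I f \<Longrightarrow> quotient_closure I q f"
| add: "quotient_closure I q f \<Longrightarrow> quotient_closure I q g \<Longrightarrow> quotient_closure I q (\<lambda>s. f s + g s)"
| scale: "smooth_fun_on I p \<Longrightarrow> quotient_closure I q f \<Longrightarrow> quotient_closure I q (\<lambda>s. p s *\<^sub>R f s)"
| quot: "quotient_closure I q f \<Longrightarrow> quotient_closure I q (\<lambda>s. (1 / q s) *\<^sub>R f s)"

lemma quotient_closure_deriv:
  assumes "quotient_closure I q f" "open I" "smooth_fun_on I q" "\<And>s. s \<in> I \<Longrightarrow> q s \<noteq> 0"
  shows "\<exists>f'. quotient_closure I q f' \<and> (\<forall>s\<in>I. (f has_vector_derivative f' s) (at s))"
  using assms(1)
proof induction
  case (base f)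
  then show ?case
    using smooth_has_vderiv[OF assms(2)] smooth_vderiv quotient_closure.base by blast
next
  case (add f g)
  then obtain f' g' where "quotient_closure I q f'" "quotient_closure I q g'"
    "\<forall>s\<in>I. (f has_vector_derivative f' s) (at s)" "\<forall>s\<in>I. (g has_vector_derivative g' s) (at s)"
    by blast
  then show ?case
    by (intro exI[of _ "\<lambda>s. f' s + g' s"]) (auto intro: quotient_closure.add has_vector_derivative_add)
next
  case (scale p f)
  then obtain f' where f': "quotient_closure I q f'" "\<forall>s\<in>I. (f has_vector_derivative f' s) (at s)"
    by blast
  have p: "(p has_vector_derivative vderiv p s) (at s)" if "s \<in> I" for s
    using smooth_has_vderiv[OF assms(2) scale(1) that] .
  show ?case
  proof (intro exI[of _ "\<lambda>s. p s *\<^sub>R f' s + vderiv p s *\<^sub>R f s"] conjI ballI)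
    show "quotient_closure I q (\<lambda>s. p s *\<^sub>R f' s + vderiv p s *\<^sub>R f s)"
      using scale f' by (intro quotient_closure.add quotient_closure.scale smooth_vderiv)
    show "((\<lambda>s. p s *\<^sub>R f s) has_vector_derivative p s *\<^sub>R f' s + vderiv p s *\<^sub>R f s) (at s)"
      if "s \<in> I" for s
      using p[OF that] f'(2) that
      by (intro has_vector_derivative_scaleR) (auto simp: has_real_derivative_iff_has_vector_derivative)
  qed
next
  case (quot f)
  then obtain f' where f': "quotient_closure I q f'" "\<forall>s\<in>I. (f has_vector_derivative f' s) (at s)"
    by blast
  have q: "(q has_real_derivative vderiv q s) (at s)" if "s \<in> I" for s
    using smooth_has_vderiv[OF assms(2,3) that]
    by (simp add: has_real_derivative_iff_has_vector_derivative)
  let ?d = "\<lambda>s. (1 / q s) *\<^sub>R f' s + (-1) *\<^sub>R (vderiv q s *\<^sub>R ((1 / q s) *\<^sub>R ((1 / q s) *\<^sub>R f s)))"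
  show ?case
  proof (intro exI[of _ ?d] conjI ballI)
    show "quotient_closure I q ?d"
      using quot f' assms(2,3)
      by (intro quotient_closure.add quotient_closure.scale quotient_closure.quot
          smooth_vderiv smooth_const)
    fix s assume s: "s \<in> I"
    have "((\<lambda>s. 1 / q s) has_real_derivative - (vderiv q s / (q s * q s))) (at s)"
      using assms(4)[OF s] by (auto intro!: derivative_eq_intros q s)
    then have "((\<lambda>s. (1 / q s) *\<^sub>R f s) has_vector_derivative
        (1 / q s) *\<^sub>R f' s + (- (vderiv q s / (q s * q s))) *\<^sub>R f s) (at s)"
      using f'(2) s by (intro has_vector_derivative_scaleR) auto
    then show "((\<lambda>s. (1 / q s) *\<^sub>R f s) has_vector_derivative ?d s) (at s)"
      by simp
  qed
qed

text \<open>For \<open>f\<close> the identity this is smoothness of the inverse function \<open>\<phi>\<close> itself.\<close>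

lemma smooth_compose_inverse:
  assumes "open I" "open I'" "smooth_fun_on I q" "\<And>s. s \<in> I \<Longrightarrow> q s \<noteq> 0"
    and \<phi>: "\<And>y. y \<in> I' \<Longrightarrow> \<phi> y \<in> I"
    and d: "\<And>y. y \<in> I' \<Longrightarrow> (\<phi> has_real_derivative 1 / q (\<phi> y)) (at y)"
    and f: "smooth_fun_on I (f :: real \<Rightarrow> 'a::real_normed_vector)"
  shows "smooth_fun_on I' (\<lambda>y. f (\<phi> y))"
proof (rule smooth_coinduct[where F = "{\<lambda>y. h (\<phi> y) | h. quotient_closure I q h}"])
  show "(\<lambda>y. f (\<phi> y)) \<in> {\<lambda>y. h (\<phi> y) | h. quotient_closure I q h}"
    using quotient_closure.base[OF f] by blast
next
  fix k :: "real \<Rightarrow> 'a" assume "k \<in> {\<lambda>y. h (\<phi> y) | h. quotient_closure I q h}"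
  then obtain h where h: "quotient_closure I q h" and k: "k = (\<lambda>y. h (\<phi> y))" by blast
  obtain h' where h': "quotient_closure I q h'" "\<forall>s\<in>I. (h has_vector_derivative h' s) (at s)"
    using quotient_closure_deriv[OF h assms(1,3,4)] by blast
  have "(k has_vector_derivative (1 / q (\<phi> y)) *\<^sub>R h' (\<phi> y)) (at y)" if "y \<in> I'" for y
  proof -
    have "(\<phi> has_vector_derivative 1 / q (\<phi> y)) (at y)"
      using d[OF that] by (simp add: has_real_derivative_iff_has_vector_derivative)
    moreover have "(h has_vector_derivative h' (\<phi> y)) (at (\<phi> y))"
      using h'(2) \<phi>[OF that] by blast
    ultimately show ?thesis
      unfolding k using vector_diff_chain_at[of \<phi> _ y h] by (simp add: o_def)
  qed
  moreover have "quotient_closure I q (\<lambda>s. (1 / q s) *\<^sub>R h' s)"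
    by (rule quotient_closure.quot[OF h'(1)])
  ultimately show "\<exists>f'\<in>{\<lambda>y. h (\<phi> y) | h. quotient_closure I q h}.
      \<forall>s\<in>I'. (k has_vector_derivative f' s) (at s)"
    by (intro bexI[of _ "\<lambda>y. (1 / q (\<phi> y)) *\<^sub>R h' (\<phi> y)"]) auto
qed (rule assms)

lemma smooth_bounded_linear:
  assumes "open I" "bounded_linear L" "smooth_fun_on I f"
  shows "smooth_fun_on I (\<lambda>s. L (f s))"
proof (rule smooth_coinduct[where F = "{\<lambda>s. L (f s) | f. smooth_fun_on I f}"])
  show "(\<lambda>s. L (f s)) \<in> {\<lambda>s. L (f s) | f. smooth_fun_on I f}"
    using assms(3) by blast
next
  fix h assume "h \<in> {\<lambda>s. L (f s) | f. smooth_fun_on I f}"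
  then obtain f where f: "smooth_fun_on I f" and h: "h = (\<lambda>s. L (f s))" by blast
  have "\<forall>s\<in>I. (h has_vector_derivative L (vderiv f s)) (at s)"
    unfolding h using bounded_linear.has_vector_derivative[OF assms(2)] smooth_has_vderiv[OF assms(1) f]
    by blast
  then show "\<exists>f'\<in>{\<lambda>s. L (f s) | f. smooth_fun_on I f}. \<forall>s\<in>I. (h has_vector_derivative f' s) (at s)"
    using smooth_vderiv[OF f] by (intro bexI[of _ "\<lambda>s. L (vderiv f s)"]) auto
qed (rule assms)

text \<open>The parameter change: the interval structure gives strict monotonicity, invariance of domain the
  openness of the image, and the inverse function theorem the derivative.\<close>

lemma inverse_of_increasing:
  fixes g g' :: "real \<Rightarrow> real"
  assumes I: "open_interval I"
    and d: "\<And>s. s \<in> I \<Longrightarrow> (g has_real_derivative g' s) (at s)"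
    and pos: "\<And>s. s \<in> I \<Longrightarrow> g' s > 0"
  obtains \<phi> where "open_interval (g ` I)" "bij_betw \<phi> (g ` I) I"
    "\<And>s. s \<in> I \<Longrightarrow> \<phi> (g s) = s" "\<And>y. y \<in> g ` I \<Longrightarrow> (\<phi> has_real_derivative 1 / g' (\<phi> y)) (at y)"
proof -
  have oI: "open I" "is_interval I" "I \<noteq> {}" using I by (auto simp: open_interval_def)
  have cont: "continuous_on I g"
    using d by (meson DERIV_isCont continuous_at_imp_continuous_on)
  have less: "g a < g b" if "a \<in> I" "b \<in> I" "a < b" for a b
  proof (rule DERIV_pos_imp_increasing[OF \<open>a < b\<close>])
    fix x assume "a \<le> x" "x \<le> b"
    then have "x \<in> I"
      using oI(2) that by (meson mem_is_interval_1_I)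
    then show "\<exists>y. (g has_real_derivative y) (at x) \<and> 0 < y"
      using d pos by blast
  qed
  then have inj: "inj_on g I"
    by (metis inj_onI linorder_neqE_linordered_idom order_less_irrefl)
  define \<phi> where "\<phi> = the_inv_into I g"
  have \<phi>g: "\<phi> (g s) = s" if "s \<in> I" for s
    using that inj by (simp add: \<phi>_def the_inv_into_f_f)
  have "open (g ` I)"
    by (rule invariance_of_domain[OF cont oI(1) inj])
  moreover have "is_interval (g ` I)"
    using connected_continuous_image[OF cont] oI(2) by (simp add: is_interval_connected_1)
  ultimately have "open_interval (g ` I)"
    using oI(3) by (simp add: open_interval_def)
  moreover have "bij_betw \<phi> (g ` I) I"
    unfolding \<phi>_def by (rule bij_betw_the_inv_into) (use inj in \<open>simp add: bij_betw_def\<close>)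
  moreover have "(\<phi> has_real_derivative 1 / g' (\<phi> y)) (at y)" if y: "y \<in> g ` I" for y
  proof -
    obtain s where s: "s \<in> I" "y = g s" using y by blast
    have "(\<phi> has_derivative (*) (1 / g' s)) (at (g s))"
    proof (rule has_derivative_inverse_strong[OF oI(1) s(1) cont])
      show "(g has_derivative (*) (g' s)) (at s)"
        using d[OF s(1)] by (simp add: has_field_derivative_def)
      show "(*) (g' s) \<circ> (*) (1 / g' s) = id"
        using pos[OF s(1)] by (auto simp: fun_eq_iff)
    qed (rule \<phi>g)
    then show ?thesis
      using s \<phi>g by (simp add: has_field_derivative_def)
  qed
  ultimately show ?thesis
    using \<phi>g that by blast
qed

section \<open>Derivatives of vector-valued curves\<close>

lemma derivative_of_constant:
  fixes f :: "real \<Rightarrow> 'a::real_normed_vector"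
  assumes "(f has_vector_derivative f') (at s)" "open U" "s \<in> U" "\<And>x. x \<in> U \<Longrightarrow> f x = c"
  shows "f' = 0"
proof -
  have "((\<lambda>x. c) has_vector_derivative f') (at s)"
    by (rule has_vector_derivative_transform_within_open[OF assms(1-3)]) (rule assms(4))
  then show ?thesis
    by (rule vector_derivative_unique_at[OF _ has_vector_derivative_const])
qed

lemma real_derivative_of_constant:
  assumes "(f has_real_derivative f') (at s)" "open U" "s \<in> U" "\<And>x. x \<in> U \<Longrightarrow> f x = c"
  shows "f' = 0"
  by (rule derivative_of_constant[OF assms(1)[unfolded has_real_derivative_iff_has_vector_derivative] assms(2,3)])
     (rule assms(4))

lemma constant_if_derivative_zero:
  fixes f :: "real \<Rightarrow> 'a::real_normed_vector"
  assumes "open_interval I" "\<And>s. s \<in> I \<Longrightarrow> (f has_vector_derivative 0) (at s)"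
  obtains c where "\<And>s. s \<in> I \<Longrightarrow> f s = c"
proof -
  have "convex I" using assms(1) by (simp add: open_interval_def is_interval_convex)
  moreover have "(f has_derivative (\<lambda>h. 0)) (at s within I)" if "s \<in> I" for s
    using assms(2)[OF that] by (simp add: has_vector_derivative_def has_derivative_at_withinI)
  ultimately show ?thesis
    using has_derivative_zero_constant[of I f] that by blast
qed

lemma cross_has_vector_derivative:
  assumes "(f has_vector_derivative f') (at s)" "(g has_vector_derivative g') (at s)"
  shows "((\<lambda>s. f s \<times> g s) has_vector_derivative (f s \<times> g' + f' \<times> g s)) (at s)"
proof -
  have "bounded_bilinear (\<times>)"
    using bilinear_cross bilinear_conv_bounded_bilinear by blast
  then show ?thesis
    using bounded_bilinear.has_vector_derivative assms by blast
qed

lemma inner_has_real_derivative: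
  fixes f g :: "real \<Rightarrow> 'a::real_inner"
  assumes "(f has_vector_derivative f') (at s)" "(g has_vector_derivative g') (at s)"
  shows "((\<lambda>s. f s \<bullet> g s) has_real_derivative (f s \<bullet> g' + f' \<bullet> g s)) (at s)"
  unfolding has_real_derivative_iff_has_vector_derivative
  using bounded_bilinear.has_vector_derivative[OF bounded_bilinear_inner assms] .

lemma bounded_linear_flip: "bounded_linear flip"
  by (simp add: linear_conv_bounded_linear[symmetric] linear_iff vec_eq_iff forall_3)

lemma mink_has_real_derivative:
  assumes "(f has_vector_derivative f') (at s)" "(g has_vector_derivative g') (at s)"
  shows "((\<lambda>s. mink (f s) (g s)) has_real_derivative mink (f s) g' + mink f' (g s)) (at s)"
  using inner_has_real_derivative[OF assms(1)
      bounded_linear.has_vector_derivative[OF bounded_linear_flip assms(2)]]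
  by (simp only: inner_flip)

text \<open>If \<open>u'\<close> is parallel to \<open>u\<close>, the normalized curve \<open>u / \<bar>u\<bar>\<close> has derivative
  \<open>(\<bar>u\<bar>\<^sup>2 u' - (u \<bullet> u') u) / \<bar>u\<bar>\<^sup>3 = - u \<times> (u \<times> u') / \<bar>u\<bar>\<^sup>3 = 0\<close>.\<close>

lemma constant_direction:
  fixes u u' :: "real \<Rightarrow> real^3"
  assumes I: "open_interval I"
    and d: "\<And>s. s \<in> I \<Longrightarrow> (u has_vector_derivative u' s) (at s)"
    and nz: "\<And>s. s \<in> I \<Longrightarrow> u s \<noteq> 0"
    and par: "\<And>s. s \<in> I \<Longrightarrow> u s \<times> u' s = 0"
  obtains a where "a \<noteq> 0" "\<And>s. s \<in> I \<Longrightarrow> u s = norm (u s) *\<^sub>R a"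
proof -
  let ?r = "\<lambda>s. norm (u s)"
  have dz: "((\<lambda>s. (1 / ?r s) *\<^sub>R u s) has_vector_derivative 0) (at s)" if s: "s \<in> I" for s
  proof -
    have r: "?r s > 0" using nz[OF s] by simp
    have "((\<lambda>s. sqrt (u s \<bullet> u s)) has_real_derivative (u s \<bullet> u' s) / ?r s) (at s)"
      using inner_has_real_derivative[OF d[OF s] d[OF s]] r
      by (auto intro!: derivative_eq_intros simp: inner_commute norm_eq_sqrt_inner field_simps)
         (meson inner_ge_zero not_less)
    then have dr: "(?r has_real_derivative (u s \<bullet> u' s) / ?r s) (at s)"
      by (simp only: norm_eq_sqrt_inner[symmetric])
    have "((\<lambda>s. 1 / ?r s) has_real_derivative - ((u s \<bullet> u' s) / ?r s / (?r s * ?r s))) (at s)"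
      using r by (auto intro!: derivative_eq_intros dr)
    then have *: "((\<lambda>s. (1 / ?r s) *\<^sub>R u s) has_vector_derivative
        (1 / ?r s) *\<^sub>R u' s + (- ((u s \<bullet> u' s) / ?r s / (?r s * ?r s))) *\<^sub>R u s) (at s)"
      by (intro has_vector_derivative_scaleR d s)
    have "u s \<times> (u s \<times> u' s) = 0" using par[OF s] by simp
    then have "(u s \<bullet> u' s) *\<^sub>R u s = (?r s * ?r s) *\<^sub>R u' s"
      by (simp add: Lagrange power2_norm_eq_inner[symmetric] power2_eq_square)
    moreover have "(- ((u s \<bullet> u' s) / ?r s / (?r s * ?r s))) *\<^sub>R u s
        = (- 1 / (?r s * ?r s * ?r s)) *\<^sub>R ((u s \<bullet> u' s) *\<^sub>R u s)"
      by simp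
    ultimately show ?thesis
      using * r by simp
  qed
  obtain a where a: "\<And>s. s \<in> I \<Longrightarrow> (1 / ?r s) *\<^sub>R u s = a"
    using constant_if_derivative_zero[OF I dz] by blast
  obtain s0 where s0: "s0 \<in> I" using I by (auto simp: open_interval_def)
  show ?thesis
  proof
    show "a \<noteq> 0" using a[OF s0] nz[OF s0] by auto
    show "u s = norm (u s) *\<^sub>R a" if "s \<in> I" for s
      using a[OF that, symmetric] nz[OF that] by simp
  qed
qed

section \<open>Polynomial identities along a ruling\<close>

lemma cubic_coefficients_zero:
  fixes a0 a1 a2 a3 :: real
  assumes "infinite S" "\<And>t. t \<in> S \<Longrightarrow> a0 + a1 * t + a2 * t^2 + a3 * t^3 = 0"
  shows "a0 = 0 \<and> a1 = 0 \<and> a2 = 0 \<and> a3 = 0"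
proof -
  let ?p = "[:a0, a1, a2, a3:]"
  have p: "poly ?p t = a0 + a1 * t + a2 * t^2 + a3 * t^3" for t
    by (simp add: algebra_simps power2_eq_square power3_eq_cube)
  have "S \<subseteq> {t. poly ?p t = 0}"
  proof
    fix t assume "t \<in> S"
    then show "t \<in> {t. poly ?p t = 0}"
      using assms(2) by (simp only: p mem_Collect_eq)
  qed
  then have "infinite {t. poly ?p t = 0}"
    using assms(1) finite_subset by blast
  then have "?p = 0"
    using poly_roots_finite[of ?p] by blast
  then show ?thesis by simp
qed

text \<open>The right-hand side is a polynomial only up to the sign of the quadratic, but one of the two signs
  occurs for infinitely many \<open>t\<close>. The factor \<open>\<kappa>\<close> is the resulting sign.\<close>

lemma abs_identity_coefficients:
  fixes p0 p1 p2 d0 d1 d2 q0 q1 :: real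
  assumes J: "infinite J"
    and eq: "\<And>t. t \<in> J \<Longrightarrow>
      p0 + p1 * t + p2 * t^2 = - \<bar>d0 + d1 * t + d2 * t^2\<bar> * (q0 + q1 * t)"
  obtains \<kappa> where "\<kappa> \<noteq> 0" "d2 * q1 = 0" "p2 = \<kappa> * (d1 * q1 + d2 * q0)" "p1 = \<kappa> * (d0 * q1 + d1 * q0)"
proof -
  let ?D = "\<lambda>t. d0 + d1 * t + d2 * t^2"
  have "J = {t \<in> J. ?D t \<ge> 0} \<union> {t \<in> J. ?D t < 0}" by auto
  with J have "infinite ({t \<in> J. ?D t \<ge> 0} \<union> {t \<in> J. ?D t < 0})" by (rule back_subst[where P = infinite])
  then have "infinite {t \<in> J. ?D t \<ge> 0} \<or> infinite {t \<in> J. ?D t < 0}"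
    by (rule infinite_Un[THEN iffD1])
  then obtain \<kappa> S where k: "\<kappa> \<in> {-1, 1 :: real}" and S: "infinite S" "S \<subseteq> J"
    and abs: "\<And>t. t \<in> S \<Longrightarrow> - \<bar>?D t\<bar> = \<kappa> * ?D t"
  proof
    assume "infinite {t \<in> J. ?D t \<ge> 0}"
    then show thesis by (intro that[of "-1" "{t \<in> J. ?D t \<ge> 0}"]) auto
  next
    assume "infinite {t \<in> J. ?D t < 0}"
    then show thesis by (intro that[of 1 "{t \<in> J. ?D t < 0}"]) auto
  qed
  have "(p0 - \<kappa> * (d0 * q0)) + (p1 - \<kappa> * (d0 * q1 + d1 * q0)) * t
      + (p2 - \<kappa> * (d1 * q1 + d2 * q0)) * t^2 + (- \<kappa> * (d2 * q1)) * t^3 = 0" if "t \<in> S" for t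
  proof -
    have "p0 + p1 * t + p2 * t^2 = \<kappa> * ?D t * (q0 + q1 * t)"
      using eq[of t] abs[OF that] S(2) that by auto
    then show ?thesis
      by (simp add: algebra_simps power2_eq_square power3_eq_cube)
  qed
  note c = cubic_coefficients_zero[OF S(1) this]
  show ?thesis
    using c k by (intro that[of \<kappa>]) auto
qed

section \<open>The soliton equation in terms of determinants\<close>

text \<open>The normal part is the Minkowski-orthogonal projection to the line of the normal
  \<open>n\<close>, which is not isotropic because the induced metric is non-degenerate.\<close>

lemma normal_part_eq:
  assumes nd: "nondegenerate_at X s t"
  defines "n \<equiv> flip (d1 X s t \<times> d2 X s t)"
  shows "normal_part X s t u = (mink u n / mink n n) *\<^sub>R n"
proof -
  let ?a = "d1 X s t" and ?b = "d2 X s t"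
  have nn: "mink n n \<noteq> 0"
    using nd by (simp add: n_def mink_normal_self nondegenerate_at_def fff_det_def fffE_def fffF_def fffG_def)
  then have ab: "?a \<times> ?b \<noteq> 0"
    by (auto simp: n_def mink_def)
  have T: "tangent_plane X s t = {y. mink y n = 0}"
    by (simp add: tangent_plane_def span_pair_eq_orthogonal_cross[OF ab] n_def mink_flip)
  show ?thesis
    unfolding normal_part_def T
  proof (rule the_equality, intro conjI ballI)
    show "u - (mink u n / mink n n) *\<^sub>R n \<in> {y. mink y n = 0}"
      using nn by (simp add: mink_linear_simps)
    show "mink ((mink u n / mink n n) *\<^sub>R n) y = 0" if "y \<in> {y. mink y n = 0}" for y
      using that by (simp add: mink_linear_simps mink_commute)
  next
    fix m assume m: "u - m \<in> {y. mink y n = 0} \<and> (\<forall>y\<in>{y. mink y n = 0}. mink m y = 0)"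
    have mn: "mink m n = mink u n"
      using m by (simp add: mink_linear_simps)
    have "m \<bullet> flip ?a = 0" "m \<bullet> flip ?b = 0"
      using m by (auto simp: inner_flip n_def mink_flip dot_cross_self)
    then have "mink m ?a = 0" "mink m ?b = 0"
      by (simp_all add: inner_flip)
    moreover have "mink n ?a = 0" "mink n ?b = 0"
      by (simp_all add: n_def mink_flip mink_commute[of "flip _"] dot_cross_self)
    ultimately have "m \<times> n = 0"
      using mink_orthogonal_two_parallel[OF _ _ _ _ ab] by blast
    have "(mink n n) *\<^sub>R m - (mink m n) *\<^sub>R n = (flip n) \<times> (m \<times> n)"
      by (simp add: Lagrange inner_flip inner_commute[of "flip n"])
    then have "(mink n n) *\<^sub>R m = (mink m n) *\<^sub>R n"
      using \<open>m \<times> n = 0\<close> by simp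
    then have "(1 / mink n n) *\<^sub>R ((mink n n) *\<^sub>R m) = (mink m n / mink n n) *\<^sub>R n"
      by simp
    then show "m = (mink u n / mink n n) *\<^sub>R n"
      using nn by (simp add: mn)
  qed
qed

text \<open>Inserting the unit normal \<open>flip n / \<surd>\<bar>D\<bar>\<close> into \<open>2 H = \<langle>N, v\<rangle>\<close>. One factor \<open>D\<close> in the denominator comes
  from the inverse metric and one from the projection to the normal, while \<open>\<langle>N, v\<rangle> N\<close> contributes only
  \<open>\<bar>D\<bar>\<close>; this leaves the absolute value on the right. The term with \<open>X\<^sub>t\<^sub>t\<close> is absent, as for
  every parametrization whose \<open>t\<close>-lines are straight and affinely parametrized.\<close>

lemma soliton_determinant_equation:
  assumes sol: "translating_soliton I J X v" and "s \<in> I" "t \<in> J" and tt: "d2 (d2 X) s t = 0"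
  defines "n \<equiv> d1 X s t \<times> d2 X s t"
  shows "fffG X s t * (d1 (d1 X) s t \<bullet> n) - 2 * fffF X s t * (d2 (d1 X) s t \<bullet> n)
    = - \<bar>fff_det X s t\<bar> * (v \<bullet> n)"
proof -
  let ?a = "d1 X s t" and ?b = "d2 X s t" and ?D = "fff_det X s t"
  let ?m = "flip n"
  have nd: "nondegenerate_at X s t"
    using assms by (auto simp: translating_soliton_def)
  then have D: "?D \<noteq> 0"
    by (simp add: nondegenerate_at_def)
  have mm: "mink ?m ?m = - ?D"
    by (simp add: n_def mink_normal_self fff_det_def fffE_def fffF_def fffG_def)
  have m0: "?m \<noteq> 0"
    using mm D by (auto simp: mink_def)
  then have ab: "?a \<times> ?b \<noteq> 0"
    by (simp add: n_def)
  define r where "r = 1 / sqrt \<bar>?D\<bar>"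
  have r2: "r * r = 1 / \<bar>?D\<bar>"
    using D by (simp add: r_def)
  have "unit_normal X s t (r *\<^sub>R ?m)"
    unfolding unit_normal_def
  proof
    show "\<forall>y\<in>tangent_plane X s t. mink (r *\<^sub>R ?m) y = 0"
      by (auto simp: tangent_plane_def span_pair_eq_orthogonal_cross[OF ab] n_def mink_linear_simps
          mink_commute[of "flip _"] mink_flip)
    have "mink (r *\<^sub>R ?m) (r *\<^sub>R ?m) = - ?D * (r * r)"
      by (simp add: mink_linear_simps mm)
    then show "mink (r *\<^sub>R ?m) (r *\<^sub>R ?m) \<in> {-1, 1}"
      using D by (auto simp: r2 abs_if)
  qed
  then obtain H where H: "mean_curvature_vector X s t = H *\<^sub>R (r *\<^sub>R ?m)"
     and Hv: "2 * H = mink (r *\<^sub>R ?m) v"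
    using assms unfolding translating_soliton_def is_mean_curvature_def by blast
  have np: "normal_part X s t u = (- (u \<bullet> n) / ?D) *\<^sub>R ?m" for u
    using normal_part_eq[OF nd, of u] unfolding n_def[symmetric] mm by (simp add: mink_flip)
  let ?L = "fffG X s t * (d1 (d1 X) s t \<bullet> n) - 2 * fffF X s t * (d2 (d1 X) s t \<bullet> n)"
  have "mean_curvature_vector X s t = (- ?L / (2 * ?D * ?D)) *\<^sub>R ?m"
    by (simp add: mean_curvature_vector_def sff11_def sff12_def sff22_def np tt
        scaleR_diff_left[symmetric] scaleR_left_diff_distrib[symmetric] divide_simps D)
  with H have "(- ?L / (2 * ?D * ?D)) *\<^sub>R ?m = (H * r) *\<^sub>R ?m"
    by simp
  then have "- ?L / (2 * ?D * ?D) = H * r"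
    using m0 by (simp only: scaleR_cancel_right) simp
  also have "2 * (H * r) = (v \<bullet> n) * (r * r)"
    using Hv by (simp add: mink_linear_simps mink_commute[of "flip _"] mink_flip)
  then have "H * r = (v \<bullet> n) / (2 * \<bar>?D\<bar>)"
    by (simp add: r2)
  finally have e: "- ?L / (2 * ?D * ?D) = (v \<bullet> n) / (2 * \<bar>?D\<bar>)" .
  have "x = - (2 * ?D * ?D) * (- x / (2 * ?D * ?D))" for x
    using D by simp
  from this[of ?L] have "?L = - (2 * ?D * ?D) * ((v \<bullet> n) / (2 * \<bar>?D\<bar>))"
    by (simp only: e)
  then show "?L = - \<bar>?D\<bar> * (v \<bullet> n)"
    using D by (simp add: abs_if split: if_splits)
qed

section \<open>Ruled translating solitons\<close>

lemma ruled_derivatives: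
  assumes "open I" "smooth_fun_on I \<gamma>" "smooth_fun_on I w" "s \<in> I"
  shows "d1 (ruled \<gamma> w) s t = vderiv \<gamma> s + t *\<^sub>R vderiv w s"
    and "d2 (ruled \<gamma> w) s t = w s"
    and "d1 (d1 (ruled \<gamma> w)) s t = vderiv (vderiv \<gamma>) s + t *\<^sub>R vderiv (vderiv w) s"
    and "d2 (d1 (ruled \<gamma> w)) s t = vderiv w s"
    and "d2 (d2 (ruled \<gamma> w)) s t = 0"
proof -
  have d1: "d1 (ruled \<gamma> w) s t = vderiv \<gamma> s + t *\<^sub>R vderiv w s" if "s \<in> I" for s t
    unfolding d1_def ruled_def
    by (intro vderiv_eqI has_vector_derivative_add has_vector_derivative_const
        bounded_linear.has_vector_derivative[OF bounded_linear_scaleR_right] smooth_has_vderiv[OF assms(1)] assms that)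
  show "d1 (ruled \<gamma> w) s t = vderiv \<gamma> s + t *\<^sub>R vderiv w s"
    by (rule d1[OF assms(4)])
  have line: "vderiv (\<lambda>t. a + t *\<^sub>R b) t = b" for a b :: "real^3" and t
    by (rule vderiv_eqI) (auto intro!: derivative_eq_intros)
  have d2: "d2 (ruled \<gamma> w) = (\<lambda>s t. w s)"
    by (simp add: fun_eq_iff d2_def ruled_def line)
  show "d2 (ruled \<gamma> w) s t = w s"
    by (simp add: d2)
  show "d2 (d2 (ruled \<gamma> w)) s t = 0"
    unfolding d2 unfolding d2_def by (rule vderiv_eqI) (rule has_vector_derivative_const)
  show "d2 (d1 (ruled \<gamma> w)) s t = vderiv w s"
    unfolding d2_def d1[OF assms(4)] by (rule line)
  have "((\<lambda>s. vderiv \<gamma> s + t *\<^sub>R vderiv w s) has_vector_derivative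
      vderiv (vderiv \<gamma>) s + t *\<^sub>R vderiv (vderiv w) s) (at s)"
    by (intro has_vector_derivative_add bounded_linear.has_vector_derivative[OF bounded_linear_scaleR_right]
        smooth_has_vderiv[OF assms(1)] smooth_vderiv assms)
  then have "((\<lambda>s. d1 (ruled \<gamma> w) s t) has_vector_derivative
      vderiv (vderiv \<gamma>) s + t *\<^sub>R vderiv (vderiv w) s) (at s)"
    by (rule has_vector_derivative_transform_within_open[OF _ assms(1,4)]) (simp add: d1)
  then show "d1 (d1 (ruled \<gamma> w)) s t = vderiv (vderiv \<gamma>) s + t *\<^sub>R vderiv (vderiv w) s"
    unfolding d1_def[of "d1 (ruled \<gamma> w)"] by (rule vderiv_eqI)
qed

subsection \<open>The soliton equation along a ruling\<close>

locale ruled_soliton =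
  fixes I J :: "real set" and \<gamma> w :: "real \<Rightarrow> real^3" and v :: "real^3"
  assumes v: "v \<noteq> 0"
    and I: "open_interval I" and J: "open_interval J"
    and data: "ruled_data I \<gamma> w"
    and noncyl: "non_cylindrical I w"
    and soliton: "translating_soliton I J (ruled \<gamma> w) v"
begin

abbreviation "\<gamma>1 \<equiv> vderiv \<gamma>"
abbreviation "w1 \<equiv> vderiv w"
abbreviation "w2 \<equiv> vderiv w1"

lemma openI: "open I"
  using I by (simp add: open_interval_def)

lemma smooth: "smooth_fun_on I \<gamma>" "smooth_fun_on I w" "smooth_fun_on I w1"
  using data smooth_vderiv by (auto simp: ruled_data_def)

lemma derivs:
  assumes "s \<in> I"
  shows "(\<gamma> has_vector_derivative \<gamma>1 s) (at s)" "(w has_vector_derivative w1 s) (at s)"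
    "(w1 has_vector_derivative w2 s) (at s)"
  using smooth_has_vderiv[OF openI] smooth assms by auto

lemma continuous_derivs:
  "continuous_on I \<gamma>1" "continuous_on I w" "continuous_on I w1" "continuous_on I w2"
proof -
  have "continuous_on I f" if "smooth_fun_on I f" for f :: "real \<Rightarrow> real^3"
    using smooth_has_vderiv[OF openI that] has_vector_derivative_continuous continuous_at_imp_continuous_on
    by blast
  then show "continuous_on I \<gamma>1" "continuous_on I w" "continuous_on I w1" "continuous_on I w2"
    using smooth smooth_vderiv by auto
qed

lemma w_cross_w1:
  assumes "s \<in> I" shows "w s \<times> w1 s \<noteq> 0"
proof
  assume "w s \<times> w1 s = 0"
  then have "(w s \<bullet> w1 s) *\<^sub>R w s + (- (w s \<bullet> w s)) *\<^sub>R w1 s = 0"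
    using Lagrange[of "w s" "w s" "w1 s"] by simp
  then have "- (w s \<bullet> w s) = 0"
    using noncyl assms unfolding non_cylindrical_def by blast
  then have "1 *\<^sub>R w s + 0 *\<^sub>R w1 s = 0"
    by simp
  then have "(1::real) = 0"
    using noncyl assms unfolding non_cylindrical_def by blast
  then show False by simp
qed

text \<open>On an open set with \<open>v \<times> w = 0\<close>, \<open>w\<close> and hence \<open>w'\<close> would be multiples of \<open>v\<close>, although they are linearly
  independent.\<close>

lemma rulings_not_along_v_on_open:
  assumes "open U" "U \<subseteq> I" "s \<in> U" "\<And>x. x \<in> U \<Longrightarrow> v \<times> w x = 0"
  shows False
proof -
  have s: "s \<in> I" using assms by blast
  have "((\<lambda>x. v \<times> w x) has_vector_derivative v \<times> w1 s) (at s)"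
    using cross_has_vector_derivative[OF has_vector_derivative_const[of v] derivs(2)[OF s]] by simp
  then have "v \<times> w1 s = 0"
    by (rule derivative_of_constant[OF _ assms(1,3)]) (rule assms(4))
  then have w1: "(v \<bullet> v) *\<^sub>R w1 s = (v \<bullet> w1 s) *\<^sub>R v"
    using Lagrange[of v v "w1 s"] by simp
  have w: "(v \<bullet> v) *\<^sub>R w s = (v \<bullet> w s) *\<^sub>R v"
    using Lagrange[of v v "w s"] assms by simp
  have "((v \<bullet> v) *\<^sub>R w s) \<times> ((v \<bullet> v) *\<^sub>R w1 s) = 0"
    unfolding w w1 by (simp add: cross_mult_left cross_mult_right)
  then show False
    using v w_cross_w1[OF s] by (simp add: cross_mult_left cross_mult_right)
qed

text \<open>The rulings are transversal to \<open>v\<close> on a dense set of parameters, so a continuous function that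
  vanishes at these parameters vanishes everywhere.\<close>

lemma zero_where_transversal_imp_zero:
  fixes F :: "real \<Rightarrow> real"
  assumes "continuous_on I F" and "\<And>s. s \<in> I \<Longrightarrow> v \<times> w s \<noteq> 0 \<Longrightarrow> F s = 0" and "s \<in> I"
  shows "F s = 0"
proof (rule ccontr)
  assume "F s \<noteq> 0"
  have "open (I \<inter> F -` (- {0}))"
    by (rule continuous_open_preimage[OF assms(1) openI]) auto
  then show False
  proof (rule rulings_not_along_v_on_open)
    show "s \<in> I \<inter> F -` (- {0})"
      using \<open>F s \<noteq> 0\<close> assms(3) by simp
    show "v \<times> w x = 0" if "x \<in> I \<inter> F -` (- {0})" for x
      using that assms(2)[of x] by auto
  qed simp
qed

lemma w_orthogonal_w1:
  assumes "\<And>s. s \<in> I \<Longrightarrow> mink (w s) (w s) = c" "s \<in> I"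
  shows "mink (w s) (w1 s) = 0"
proof -
  have "mink (w s) (w1 s) + mink (w1 s) (w s) = 0"
    by (rule real_derivative_of_constant[OF mink_has_real_derivative[OF
          derivs(2)[OF assms(2)] derivs(2)[OF assms(2)]] openI assms(2)]) (rule assms(1))
  then show ?thesis
    by (simp add: mink_commute)
qed

lemma first_fundamental_form:
  assumes s: "s \<in> I" and orth: "mink (w s) (w1 s) = 0"
  shows "fffG (ruled \<gamma> w) s t = mink (w s) (w s)"
    and "fffF (ruled \<gamma> w) s t = mink (\<gamma>1 s) (w s)"
    and "fff_det (ruled \<gamma> w) s t =
      (mink (w s) (w s) * mink (\<gamma>1 s) (\<gamma>1 s) - (mink (\<gamma>1 s) (w s))\<^sup>2)
      + (2 * mink (w s) (w s) * mink (\<gamma>1 s) (w1 s)) * t + (mink (w s) (w s) * mink (w1 s) (w1 s)) * t\<^sup>2"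
  using orth
  by (simp_all add: fff_det_def fffE_def fffF_def fffG_def ruled_derivatives[OF openI smooth(1,2) s]
      mink_linear_simps mink_commute[of "w1 s" "w s"]
        mink_commute[of "w1 s" "\<gamma>1 s"] mink_commute[of "w s" "\<gamma>1 s"] algebra_simps power2_eq_square)

text \<open>The coefficients of \<open>t\<^sup>3\<close>, \<open>t\<^sup>2\<close> and \<open>t\<close> in the soliton equation along the ruling through
  \<open>\<gamma> s\<close>. On the left the part \<open>2 F (X\<^sub>s\<^sub>t \<bullet> n)\<close> is constant in \<open>t\<close>, because \<open>F\<close> is constant by
  orthogonality and \<open>w' \<bullet> (w' \<times> w) = 0\<close>.\<close>

lemma coefficient_equations:
  assumes s: "s \<in> I" and orth: "mink (w s) (w1 s) = 0"
  defines "G \<equiv> mink (w s) (w s)" and "q0 \<equiv> v \<bullet> (\<gamma>1 s \<times> w s)" and "q1 \<equiv> v \<bullet> (w1 s \<times> w s)"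
  obtains \<kappa> where "\<kappa> \<noteq> 0"
    "G * mink (w1 s) (w1 s) * q1 = 0"
    "G * (w2 s \<bullet> (w1 s \<times> w s)) = \<kappa> * (2 * G * mink (\<gamma>1 s) (w1 s) * q1 + G * mink (w1 s) (w1 s) * q0)"
    "G * (vderiv \<gamma>1 s \<bullet> (w1 s \<times> w s) + w2 s \<bullet> (\<gamma>1 s \<times> w s))
      = \<kappa> * ((G * mink (\<gamma>1 s) (\<gamma>1 s) - (mink (\<gamma>1 s) (w s))\<^sup>2) * q1 + 2 * G * mink (\<gamma>1 s) (w1 s) * q0)"
proof -
  let ?X = "ruled \<gamma> w" and ?f = "mink (\<gamma>1 s) (w s)"
  note rd = ruled_derivatives[OF openI smooth(1,2) s]
  have "infinite J"
    using J finite_imp_not_open unfolding open_interval_def by blast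
  moreover
  have "(G * (vderiv \<gamma>1 s \<bullet> (\<gamma>1 s \<times> w s)) - 2 * ?f * (w1 s \<bullet> (\<gamma>1 s \<times> w s)))
      + (G * (vderiv \<gamma>1 s \<bullet> (w1 s \<times> w s) + w2 s \<bullet> (\<gamma>1 s \<times> w s))) * t
      + (G * (w2 s \<bullet> (w1 s \<times> w s))) * t\<^sup>2
    = - \<bar>(G * mink (\<gamma>1 s) (\<gamma>1 s) - ?f\<^sup>2) + (2 * G * mink (\<gamma>1 s) (w1 s)) * t
         + (G * mink (w1 s) (w1 s)) * t\<^sup>2\<bar> * (q0 + q1 * t)" if "t \<in> J" for t
  proof -
    have n: "x \<bullet> ((\<gamma>1 s + t *\<^sub>R w1 s) \<times> w s) = x \<bullet> (\<gamma>1 s \<times> w s) + t * (x \<bullet> (w1 s \<times> w s))" for x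
      by (simp add: cross_add_left cross_mult_left inner_add_right)
    have z: "w1 s \<bullet> (w1 s \<times> w s) = 0"
      by (rule dot_cross_self)
    have "G * ((vderiv \<gamma>1 s + t *\<^sub>R w2 s) \<bullet> ((\<gamma>1 s + t *\<^sub>R w1 s) \<times> w s))
        - 2 * ?f * (w1 s \<bullet> ((\<gamma>1 s + t *\<^sub>R w1 s) \<times> w s))
      = - \<bar>fff_det ?X s t\<bar> * (v \<bullet> ((\<gamma>1 s + t *\<^sub>R w1 s) \<times> w s))"
      using soliton_determinant_equation[OF soliton s that rd(5)]
      unfolding rd first_fundamental_form(1,2)[OF s orth] G_def .
    then show ?thesis
      unfolding first_fundamental_form(3)[OF s orth] n z G_def[symmetric] q0_def[symmetric] q1_def[symmetric]
      by (simp add: inner_add_left n z algebra_simps power2_eq_square)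
  qed
  ultimately obtain \<kappa> where "\<kappa> \<noteq> 0" "G * mink (w1 s) (w1 s) * q1 = 0"
    "G * (w2 s \<bullet> (w1 s \<times> w s)) = \<kappa> * (2 * G * mink (\<gamma>1 s) (w1 s) * q1 + G * mink (w1 s) (w1 s) * q0)"
    "G * (vderiv \<gamma>1 s \<bullet> (w1 s \<times> w s) + w2 s \<bullet> (\<gamma>1 s \<times> w s))
      = \<kappa> * ((G * mink (\<gamma>1 s) (\<gamma>1 s) - ?f\<^sup>2) * q1 + 2 * G * mink (\<gamma>1 s) (w1 s) * q0)"
    by (rule abs_identity_coefficients)
  then show ?thesis
    by (rule that)
qed

lemma nondegenerate:
  assumes "s \<in> I"
  obtains t where "t \<in> J" "fff_det (ruled \<gamma> w) s t \<noteq> 0"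
  using soliton J assms unfolding translating_soliton_def nondegenerate_at_def open_interval_def by blast

subsection \<open>Lightlike rulings\<close>

text \<open>With \<open>G = 0\<close> the coefficient of \<open>t\<close> reads \<open>- \<langle>\<gamma>', w\<rangle>\<^sup>2 det(v, w', w) = 0\<close>, so \<open>v\<close> lies in the plane
  of \<open>w\<close> and \<open>w'\<close>, which is the orthogonal complement of \<open>w\<close>. As this holds for all
  \<open>s\<close>, it can be differentiated and places \<open>v\<close> on the line orthogonal to \<open>w\<close> and \<open>w'\<close>, which is the
  line of \<open>w\<close>.\<close>

lemma rulings_not_lightlike:
  assumes light: "\<And>s. s \<in> I \<Longrightarrow> lightlike (w s)"
  shows False
proof -
  have ww: "mink (w s) (w s) = 0" if "s \<in> I" for s
    using light[OF that] by (simp add: lightlike_def)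
  have ww1: "mink (w s) (w1 s) = 0" if "s \<in> I" for s
    using w_orthogonal_w1[OF ww that] .
  have vw: "mink v (w s) = 0" if s: "s \<in> I" for s
  proof -
    obtain t where "fff_det (ruled \<gamma> w) s t \<noteq> 0"
      using nondegenerate[OF s] by blast
    then have "mink (\<gamma>1 s) (w s) \<noteq> 0"
      using first_fundamental_form(3)[OF s ww1[OF s]] ww[OF s] by auto
    then have "v \<bullet> (w1 s \<times> w s) = 0"
      using ww[OF s] by (auto intro: coefficient_equations[OF s ww1[OF s]])
    moreover have "w1 s \<times> w s \<noteq> 0"
      using w_cross_w1[OF s] cross_skew[of "w s"] by auto
    ultimately obtain p q where "v = p *\<^sub>R w1 s + q *\<^sub>R w s"
      by (rule in_span_cross)
    then show ?thesis
      using ww[OF s] ww1[OF s] by (simp add: mink_linear_simps mink_commute[of "w1 s" "w s"])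
  qed
  have "v \<times> w s = 0" if s: "s \<in> I" for s
  proof -
    have "mink v (w1 s) + mink 0 (w s) = 0"
      by (rule real_derivative_of_constant[OF mink_has_real_derivative[OF
            has_vector_derivative_const derivs(2)[OF s]] openI s]) (rule vw)
    then have "mink v (w1 s) = 0"
      by (simp add: mink_linear_simps)
    then show ?thesis
      using mink_orthogonal_two_parallel[OF vw[OF s] _ ww[OF s] ww1[OF s] w_cross_w1[OF s]] by blast
  qed
  moreover obtain s where "s \<in> I" using I by (auto simp: open_interval_def)
  ultimately show False
    using rulings_not_along_v_on_open[OF openI order_refl] by blast
qed

subsection \<open>Rulings whose derivative is not lightlike\<close>

text \<open>Where \<open>v\<close> and \<open>w\<close> are independent, \<open>w'\<close>, \<open>w''\<close> and (by the coefficient of \<open>t\<^sup>2\<close>) \<open>\<gamma>'\<close> all lie in the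
  plane of \<open>v\<close> and \<open>w\<close>. This plane is not defined where \<open>v\<close> is parallel to \<open>w\<close>, so the conclusions are
  rewritten in terms of the plane of \<open>w\<close> and \<open>w'\<close> and extended by density. The Euclidean normal
  \<open>w \<times> w'\<close> of this plane then has constant direction.\<close>

lemma planar_if_w1_not_lightlike:
  assumes \<delta>: "\<delta> \<noteq> 0" and ww: "\<And>s. s \<in> I \<Longrightarrow> mink (w s) (w s) = \<delta>"
    and w1: "\<And>s. s \<in> I \<Longrightarrow> \<not> lightlike (w1 s)"
  shows "coplanar {ruled \<gamma> w s t | s t. s \<in> I \<and> t \<in> J}"
proof -
  have ww1: "mink (w s) (w1 s) = 0" if "s \<in> I" for s
    using w_orthogonal_w1[OF ww that] .
  have m: "mink (w1 s) (w1 s) \<noteq> 0" if "s \<in> I" for s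
    using w1[OF that] w_cross_w1[OF that] by (auto simp: lightlike_def)
  have q1: "v \<bullet> (w1 s \<times> w s) = 0" if s: "s \<in> I" for s
    using coefficient_equations[OF s ww1[OF s]] \<delta> ww[OF s] m[OF s] by (metis mult_eq_0_iff)
  have q1': "v \<bullet> (w2 s \<times> w s) = 0" if s: "s \<in> I" for s
  proof -
    have "v \<bullet> (w1 s \<times> w1 s + w2 s \<times> w s) + 0 \<bullet> (w1 s \<times> w s) = 0"
      by (rule real_derivative_of_constant[OF inner_has_real_derivative[OF
            has_vector_derivative_const cross_has_vector_derivative[OF derivs(3)[OF s] derivs(2)[OF s]]] openI s])
         (rule q1)
    then show ?thesis by simp
  qed
  have transversal: "w2 s \<bullet> (w1 s \<times> w s) = 0 \<and> \<gamma>1 s \<bullet> (w1 s \<times> w s) = 0"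
    if s: "s \<in> I" and t: "v \<times> w s \<noteq> 0" for s
  proof -
    have swap: "x \<bullet> (v \<times> w s) = - (v \<bullet> (x \<times> w s))" for x
      by (simp add: mink_coords algebra_simps)
    have w1n: "w1 s \<bullet> (v \<times> w s) = 0" and wn: "w s \<bullet> (v \<times> w s) = 0"
      using q1[OF s] by (simp_all add: swap)
    have w2: "w2 s \<bullet> (w1 s \<times> w s) = 0"
      using triple_eq_0_if_orthogonal[OF _ w1n wn t] q1'[OF s] by (simp add: swap)
    obtain \<kappa> where "\<kappa> \<noteq> 0" "\<delta> * (w2 s \<bullet> (w1 s \<times> w s))
        = \<kappa> * (2 * \<delta> * mink (\<gamma>1 s) (w1 s) * (v \<bullet> (w1 s \<times> w s))
          + \<delta> * mink (w1 s) (w1 s) * (v \<bullet> (\<gamma>1 s \<times> w s)))"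
      using coefficient_equations[OF s ww1[OF s]] unfolding ww[OF s] by blast
    then have "v \<bullet> (\<gamma>1 s \<times> w s) = 0"
      using w2 q1[OF s] \<delta> m[OF s] by simp
    then have "\<gamma>1 s \<bullet> (w1 s \<times> w s) = 0"
      using triple_eq_0_if_orthogonal[OF _ w1n wn t] by (simp add: swap)
    with w2 show ?thesis by blast
  qed
  \<comment> \<open>Extension to the parameters where \<open>v\<close> is parallel to \<open>w\<close>.\<close>
  have "continuous_on I (\<lambda>s. w2 s \<bullet> (w1 s \<times> w s))" "continuous_on I (\<lambda>s. \<gamma>1 s \<bullet> (w1 s \<times> w s))"
    by (intro continuous_intros continuous_on_cross continuous_derivs)+
  then have w2: "w2 s \<bullet> (w1 s \<times> w s) = 0" and \<gamma>1: "\<gamma>1 s \<bullet> (w1 s \<times> w s) = 0" if "s \<in> I" for s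
    using zero_where_transversal_imp_zero[OF _ _ that] transversal by blast+
  have dN: "((\<lambda>s. w s \<times> w1 s) has_vector_derivative w s \<times> w2 s) (at s)" if "s \<in> I" for s
    using cross_has_vector_derivative[OF derivs(2)[OF that] derivs(3)[OF that]] by simp
  \<comment> \<open>Since \<open>(w \<times> w') \<times> (w \<times> w'') = det(w, w', w'') w\<close>.\<close>
  have parN: "(w s \<times> w1 s) \<times> (w s \<times> w2 s) = 0" if "s \<in> I" for s
  proof -
    have "w s \<bullet> (w1 s \<times> w2 s) = w2 s \<bullet> (w s \<times> w1 s)"
      by (simp add: mink_coords algebra_simps)
    also have "\<dots> = - (w2 s \<bullet> (w1 s \<times> w s))"
      by (subst cross_skew) simp
    finally show ?thesis
      using w2[OF that] by (simp add: cross_cross_triple)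
  qed
  obtain a where "a \<noteq> 0" and wa: "\<And>s. s \<in> I \<Longrightarrow> w s \<times> w1 s = norm (w s \<times> w1 s) *\<^sub>R a"
    by (rule constant_direction[where u = "\<lambda>s. w s \<times> w1 s" and u' = "\<lambda>s. w s \<times> w2 s",
          OF I dN w_cross_w1 parN]) (assumption+, rule that)
  have a0: "x \<bullet> a = 0" if "s \<in> I" "x \<bullet> (w s \<times> w1 s) = 0" for s x
    using that(2) w_cross_w1[OF that(1)] by (subst (asm) wa[OF that(1)]) simp
  have "w s \<bullet> a = 0" if "s \<in> I" for s
    using a0[OF that] by (simp add: dot_cross_self)
  moreover have "\<gamma>1 s \<bullet> a = 0" if "s \<in> I" for s
    by (rule a0[OF that]) (subst cross_skew, simp add: \<gamma>1[OF that])
  then have "((\<lambda>s. \<gamma> s \<bullet> a) has_vector_derivative 0) (at s)" if "s \<in> I" for s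
    using inner_has_real_derivative[OF derivs(1)[OF that] has_vector_derivative_const[of a]] that
    by (simp add: has_real_derivative_iff_has_vector_derivative)
  then obtain c where "\<And>s. s \<in> I \<Longrightarrow> \<gamma> s \<bullet> a = c"
    using constant_if_derivative_zero[OF I] by blast
  ultimately have X: "ruled \<gamma> w s t \<bullet> a = c" if "s \<in> I" for s t
    using that by (simp add: ruled_def inner_add_left)
  obtain s0 where s0: "s0 \<in> I" using I by (auto simp: open_interval_def)
  show ?thesis
  proof (rule coplanar_if_inner_cross_const[OF w_cross_w1[OF s0]])
    fix x assume "x \<in> {ruled \<gamma> w s t | s t. s \<in> I \<and> t \<in> J}"
    then have "x \<bullet> a = c" using X by auto
    then show "x \<bullet> (w s0 \<times> w1 s0) = norm (w s0 \<times> w1 s0) * c"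
      by (subst wa[OF s0]) simp
  qed
qed

subsection \<open>Rulings whose derivative is lightlike\<close>

text \<open>Both \<open>\<langle>w', w'\<rangle>\<close> and \<open>det(w'', w', w)\<close> vanish, which leaves only \<open>\<langle>\<gamma>', w'\<rangle> det(v, w', w) = 0\<close> in the
  coefficient of \<open>t\<^sup>2\<close>. If \<open>\<langle>\<gamma>', w'\<rangle>\<close> vanished, the lightlike vector \<open>w'\<close> would be normal to the
  surface, and the induced metric would be degenerate.\<close>

lemma lightlike_w1_orthogonal_v:
  assumes \<delta>: "\<delta> \<noteq> 0" and ww: "mink (w s) (w s) = \<delta>" and ww1: "mink (w s) (w1 s) = 0"
    and w1: "lightlike (w1 s)" and w12: "w1 s \<times> w2 s = 0" and s: "s \<in> I"
  shows "mink (w1 s) v = 0"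
proof -
  have w1w1: "mink (w1 s) (w1 s) = 0" and w1n0: "w1 s \<noteq> 0"
    using w1 by (auto simp: lightlike_def)
  have "mink (\<gamma>1 s) (w1 s) \<noteq> 0"
  proof
    assume z: "mink (\<gamma>1 s) (w1 s) = 0"
    obtain t where D: "fff_det (ruled \<gamma> w) s t \<noteq> 0"
      using nondegenerate[OF s] by blast
    let ?a = "\<gamma>1 s + t *\<^sub>R w1 s"
    \<comment> \<open>The Minkowski normal of the tangent plane at \<open>(s, t)\<close>; if \<open>\<langle>\<gamma>', w'\<rangle> = 0\<close>, it is parallel to \<open>w'\<close>.\<close>
    let ?n = "flip (?a \<times> w s)"
    note rd = ruled_derivatives[OF openI smooth(1,2) s]
    have nn: "mink ?n ?n \<noteq> 0"
      using D by (simp add: mink_normal_self fff_det_def fffE_def fffF_def fffG_def rd)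
    then have "?a \<times> w s \<noteq> 0"
      by (auto simp: mink_def)
    moreover have "mink (w1 s) ?a = 0" "mink (w1 s) (w s) = 0"
      using z w1w1 ww1 by (simp_all add: mink_linear_simps mink_commute[of "w1 s" "w s"]
        mink_commute[of "w1 s" "\<gamma>1 s"] mink_commute[of "w s" "\<gamma>1 s"])
    moreover have "mink ?n ?a = 0" "mink ?n (w s) = 0"
      by (simp_all add: mink_commute[of "flip _"] mink_flip dot_cross_self)
    ultimately have "w1 s \<times> ?n = 0"
      using mink_orthogonal_two_parallel by blast
    then have e: "(w1 s \<bullet> w1 s) *\<^sub>R ?n = (w1 s \<bullet> ?n) *\<^sub>R w1 s"
      using Lagrange[of "w1 s" "w1 s" ?n] by simp
    have "mink ((w1 s \<bullet> w1 s) *\<^sub>R ?n) ((w1 s \<bullet> w1 s) *\<^sub>R ?n) = 0"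
      unfolding e by (simp add: mink_linear_simps w1w1)
    then show False
      using nn w1n0 by (simp add: mink_linear_simps)
  qed
  moreover have "w2 s \<bullet> (w1 s \<times> w s) = 0"
  proof -
    have "w2 s \<bullet> (w1 s \<times> w s) = - (w s \<bullet> (w1 s \<times> w2 s))"
      by (simp add: mink_coords algebra_simps)
    then show ?thesis by (simp add: w12)
  qed
  moreover obtain \<kappa> where "\<kappa> \<noteq> 0" "\<delta> * (w2 s \<bullet> (w1 s \<times> w s))
      = \<kappa> * (2 * \<delta> * mink (\<gamma>1 s) (w1 s) * (v \<bullet> (w1 s \<times> w s))
        + \<delta> * mink (w1 s) (w1 s) * (v \<bullet> (\<gamma>1 s \<times> w s)))"
    using coefficient_equations[OF s ww1] unfolding ww by blast
  ultimately have "v \<bullet> (w1 s \<times> w s) = 0"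
    using \<delta> w1w1 by simp
  moreover have "w1 s \<times> w s \<noteq> 0"
    using w_cross_w1[OF s] cross_skew[of "w s"] by auto
  ultimately obtain p q where "v = p *\<^sub>R w1 s + q *\<^sub>R w s"
    by (rule in_span_cross)
  then show ?thesis
    using w1w1 ww1 by (simp add: mink_linear_simps mink_commute[of "w1 s" "w s"])
qed

text \<open>A lightlike direction \<open>a\<close> has a nonzero timelike coordinate, so the coordinate \<open>w\<^sub>3 / a\<^sub>3\<close> can serve as
  the parameter \<open>g\<close> along the line; its derivative is \<open>\<bar>w'\<bar> > 0\<close>. The reparametrization is the
  change of parameter alone.\<close>

lemma lightlike_line_if_w1_lightlike:
  assumes \<delta>: "\<delta> \<noteq> 0" and ww: "\<And>s. s \<in> I \<Longrightarrow> mink (w s) (w s) = \<delta>"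
    and w1: "\<And>s. s \<in> I \<Longrightarrow> lightlike (w1 s)"
  shows "\<exists>I' \<gamma>' w' a b.
    ruled_reparametrization I \<gamma> w I' \<gamma>' w' \<and>
    lightlike a \<and>
    (\<forall>s\<in>I'. w' s = s *\<^sub>R a + b) \<and>
    (\<forall>s\<in>I'. mink (vderiv w' s) v = 0)"
proof -
  have ww1: "mink (w s) (w1 s) = 0" if "s \<in> I" for s
    using w_orthogonal_w1[OF ww that] .
  have w1w1: "mink (w1 s) (w1 s) = 0" and w1n0: "w1 s \<noteq> 0" if "s \<in> I" for s
    using w1[OF that] by (auto simp: lightlike_def)
  have w12: "w1 s \<times> w2 s = 0" if s: "s \<in> I" for s
  proof -
    have "mink (w s) (w2 s) + mink (w1 s) (w1 s) = 0"
      by (rule real_derivative_of_constant[OF mink_has_real_derivative[OF derivs(2)[OF s] derivs(3)[OF s]] openI s])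
         (rule ww1)
    moreover have "mink (w1 s) (w2 s) + mink (w2 s) (w1 s) = 0"
      by (rule real_derivative_of_constant[OF mink_has_real_derivative[OF derivs(3)[OF s] derivs(3)[OF s]] openI s])
         (rule w1w1)
    ultimately show ?thesis
      using mink_orthogonal_two_parallel[OF _ w1w1[OF s] _ _ w_cross_w1[OF s]] ww1[OF s] w1w1[OF s]
      by (simp add: mink_commute)
  qed
  obtain a where a0: "a \<noteq> 0" and w1a: "\<And>s. s \<in> I \<Longrightarrow> w1 s = norm (w1 s) *\<^sub>R a"
    using constant_direction[OF I derivs(3) w1n0 w12] by blast
  obtain s0 where s0: "s0 \<in> I" using I by (auto simp: open_interval_def)
  have "mink (norm (w1 s0) *\<^sub>R a) (norm (w1 s0) *\<^sub>R a) = 0"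
    using w1w1[OF s0] by (simp only: w1a[OF s0, symmetric])
  then have aa: "mink a a = 0"
    using w1n0[OF s0] by (simp add: mink_linear_simps)
  have a3: "a $ 3 \<noteq> 0"
  proof
    assume z: "a $ 3 = 0"
    then have "a $ 1 * a $ 1 + a $ 2 * a $ 2 = 0"
      using aa by (simp add: mink_def)
    then have "a $ 1 = 0 \<and> a $ 2 = 0"
      by (simp add: sum_squares_eq_zero_iff)
    then show False
      using z a0 by (simp add: vec_eq_iff forall_3)
  qed
  \<comment> \<open>Dividing by \<open>a\<^sub>3\<close> makes \<open>g' = \<bar>w'\<bar>\<close> and keeps \<open>g\<close> and \<open>g'\<close> linear images of smooth curves, hence smooth.\<close>
  define g where "g s = w s $ 3 / a $ 3" for s
  define q where "q s = w1 s $ 3 / a $ 3" for s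
  have qn: "q s = norm (w1 s)" if "s \<in> I" for s
    unfolding q_def by (subst w1a[OF that]) (simp add: a3)
  then have qpos: "q s > 0" if "s \<in> I" for s
    using w1n0[OF that] that by simp
  have L: "bounded_linear (\<lambda>x::real^3. x $ 3 / a $ 3)"
    by (rule bounded_linear_divide[THEN bounded_linear_compose]) (rule bounded_linear_vec_nth)
  have smooth_q: "smooth_fun_on I q"
    unfolding q_def by (rule smooth_bounded_linear[OF openI L smooth(3)])
  have dg: "(g has_vector_derivative q s) (at s)" if "s \<in> I" for s
    unfolding g_def q_def by (rule bounded_linear.has_vector_derivative[OF L derivs(2)[OF that]])
  then have dg': "(g has_real_derivative q s) (at s)" if "s \<in> I" for s
    using that by (simp add: has_real_derivative_iff_has_vector_derivative)
  have "((\<lambda>s. w s - g s *\<^sub>R a) has_vector_derivative 0) (at s)" if s: "s \<in> I" for s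
  proof -
    have "((\<lambda>s. w s - g s *\<^sub>R a) has_vector_derivative w1 s - q s *\<^sub>R a) (at s)"
      by (intro has_vector_derivative_diff derivs s
          bounded_linear.has_vector_derivative[OF bounded_linear_scaleR_left dg])
    moreover have "w1 s - q s *\<^sub>R a = 0"
      using w1a[OF s] by (simp add: qn[OF s])
    ultimately show ?thesis by simp
  qed
  then obtain b where "\<And>s. s \<in> I \<Longrightarrow> w s - g s *\<^sub>R a = b"
    using constant_if_derivative_zero[OF I] by blast
  then have wgb: "w s = g s *\<^sub>R a + b" if "s \<in> I" for s
    using that by (metis add.commute diff_add_cancel)
  obtain \<phi> where I': "open_interval (g ` I)" and bij: "bij_betw \<phi> (g ` I) I"
    and \<phi>g: "\<And>s. s \<in> I \<Longrightarrow> \<phi> (g s) = s"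
    and d\<phi>: "\<And>y. y \<in> g ` I \<Longrightarrow> (\<phi> has_real_derivative 1 / q (\<phi> y)) (at y)"
    using inverse_of_increasing[OF I dg' qpos] by blast
  define I' where "I' = g ` I"
  have oI': "open I'" using I' by (simp add: open_interval_def I'_def)
  have \<phi>I: "\<phi> y \<in> I" if "y \<in> I'" for y
    using bij that by (auto simp: bij_betw_def I'_def)
  have g\<phi>: "g (\<phi> y) = y" if "y \<in> I'" for y
    using that \<phi>g by (auto simp: I'_def)
  have q\<phi>: "q (\<phi> y) \<noteq> 0" if "y \<in> I'" for y
    using qpos[OF \<phi>I[OF that]] by simp
  have d\<phi>': "(\<phi> has_vector_derivative 1 / q (\<phi> y)) (at y)" if "y \<in> I'" for y
    using d\<phi> that by (simp add: I'_def has_real_derivative_iff_has_vector_derivative)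
  have smooth_comp: "smooth_fun_on I' (\<lambda>y. f (\<phi> y))" if "smooth_fun_on I f"
    for f :: "real \<Rightarrow> 'b::real_normed_vector"
  proof (rule smooth_compose_inverse[OF openI oI' smooth_q _ \<phi>I _ that])
    show "q s \<noteq> 0" if "s \<in> I" for s
      using qpos[OF that] by simp
  qed (use d\<phi> in \<open>simp_all add: I'_def\<close>)
  let ?w = "\<lambda>y. w (\<phi> y)" and ?\<gamma> = "\<lambda>y. \<gamma> (\<phi> y)"
  have w': "?w y = y *\<^sub>R a + b" if "y \<in> I'" for y
    using wgb[OF \<phi>I[OF that]] g\<phi>[OF that] by simp
  have "vderiv ?\<gamma> y \<noteq> 0" if "y \<in> I'" for y
  proof -
    have "(?\<gamma> has_vector_derivative (1 / q (\<phi> y)) *\<^sub>R \<gamma>1 (\<phi> y)) (at y)"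
      using vector_diff_chain_at[OF d\<phi>'[OF that] derivs(1)[OF \<phi>I[OF that]]] by (simp add: o_def)
    then show ?thesis
      using vderiv_eqI data \<phi>I[OF that] q\<phi>[OF that] by (fastforce simp: ruled_data_def)
  qed
  moreover have "?w y \<noteq> 0" if "y \<in> I'" for y
    using data \<phi>I[OF that] by (simp add: ruled_data_def)
  ultimately have "ruled_data I' ?\<gamma> ?w"
    unfolding ruled_data_def using smooth_comp smooth by blast
  moreover have "smooth_fun_on I' \<phi>"
    using smooth_comp[OF smooth_ident[OF openI]] .
  moreover have "vderiv \<phi> y \<noteq> 0" if "y \<in> I'" for y
    using vderiv_eqI[OF d\<phi>'[OF that]] q\<phi>[OF that] by simp
  ultimately have "ruled_reparametrization I \<gamma> w I' ?\<gamma> ?w"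
    unfolding ruled_reparametrization_def using I' bij smooth_const[OF oI']
    by (intro conjI exI[of _ \<phi>] exI[of _ "\<lambda>s. 1"] exI[of _ "\<lambda>s. 0"]) (auto simp: I'_def)
  moreover have "mink (vderiv ?w y) v = 0" if y: "y \<in> I'" for y
  proof -
    have "((\<lambda>y. y *\<^sub>R a + b) has_vector_derivative a) (at y)"
      by (auto intro!: derivative_eq_intros)
    then have "(?w has_vector_derivative a) (at y)"
      by (rule has_vector_derivative_transform_within_open[OF _ oI' y]) (simp add: w')
    then have "vderiv ?w y = a" by (rule vderiv_eqI)
    moreover have "mink (norm (w1 s0) *\<^sub>R a) v = 0"
      using lightlike_w1_orthogonal_v[OF \<delta> ww[OF s0] ww1[OF s0] w1[OF s0] w12[OF s0] s0]
      by (simp only: w1a[OF s0, symmetric])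
    ultimately show ?thesis
      using w1n0[OF s0] by (simp add: mink_linear_simps)
  qed
  moreover have "lightlike a"
    using a0 aa by (simp add: lightlike_def)
  ultimately have "ruled_reparametrization I \<gamma> w I' ?\<gamma> ?w \<and> lightlike a \<and>
      (\<forall>s\<in>I'. ?w s = s *\<^sub>R a + b) \<and> (\<forall>s\<in>I'. mink (vderiv ?w s) v = 0)"
    using w' by simp
  then show ?thesis
    by - (rule exI[of _ I'], rule exI[of _ ?\<gamma>], rule exI[of _ ?w], rule exI[of _ a], rule exI[of _ b])
qed

end

theorem corollary4p4:
  fixes I J :: "real set" and \<gamma> w :: "real \<Rightarrow> real^3" and v :: "real^3"
  assumes "v \<noteq> 0"
    and "open_interval I" and "open_interval J"
    and "ruled_data I \<gamma> w"
    and "non_cylindrical I w"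
    and "constant_causal_type I w"
    and "translating_soliton I J (ruled \<gamma> w) v"
    and "\<not> coplanar {ruled \<gamma> w s t | s t. s \<in> I \<and> t \<in> J}"
  shows "\<exists>I' \<gamma>' w' a b.
    ruled_reparametrization I \<gamma> w I' \<gamma>' w' \<and>
    lightlike a \<and>
    (\<forall>s\<in>I'. w' s = s *\<^sub>R a + b) \<and>
    (\<forall>s\<in>I'. mink (vderiv w' s) v = 0)"
proof -
  interpret ruled_soliton I J \<gamma> w v
    using assms by unfold_locales
  from assms(6) consider "\<forall>s\<in>I. lightlike (w s)"
    | \<delta> where "\<delta> \<in> {-1, 1}" "\<forall>s\<in>I. mink (w s) (w s) = \<delta>" "\<forall>s\<in>I. lightlike (w1 s)"
    | \<delta> where "\<delta> \<in> {-1, 1}" "\<forall>s\<in>I. mink (w s) (w s) = \<delta>" "\<forall>s\<in>I. \<not> lightlike (w1 s)"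
    unfolding constant_causal_type_def by blast
  then show ?thesis
  proof cases
    case 1
    then show ?thesis using rulings_not_lightlike by blast
  next
    case (2 \<delta>)
    then show ?thesis by (intro lightlike_line_if_w1_lightlike[of \<delta>]) auto
  next
    case (3 \<delta>)
    then have "coplanar {ruled \<gamma> w s t | s t. s \<in> I \<and> t \<in> J}"
      by (intro planar_if_w1_not_lightlike[of \<delta>]) auto
    with assms(8) show ?thesis by contradiction
  qed
qed

end
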